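(* Let $q$ be a prime power, let $H$ be a normalized generalized Hadamard matrix $\mathrm{GH}(q,v/q)$ over $\mathbb{F}_q$, and let $(C,\star)$, with $C=C_H$, be a generalized Hadamard full propelinear code (GHFP-code) of length $v$ over $\mathbb{F}_q$ coming from $H$. Let $C_1=\{\alpha\mathbf 1:\alpha\in\mathbb{F}_q\}$, $G=C/C_1$, and $\sigma(f\star C_1)=f$ for $f\in F_H$. Then the map $\psi_{F_H}:G\times G\to\mathbb{F}_q$ defined by $$\psi_{F_H}(g,h)=k\quad\text{if }\ \sigma(g)\star\sigma(h)\in k\mathbf 1\star F_H$$ is an orthogonal cocycle (with values in the additive group of $\mathbb{F}_q$), i.e. the matrix $M_{\psi_{F_H}}=[\psi_{F_H}(g,h)]_{g,h\in G}$ is a $\mathrm{GH}(q,v/q)$. Furthermore, $(C,\star)\cong E_{\psi_{F_H}}$, by an isomorphism under which the image of $F_H$ is $\{(0,g):g\in G\}$, where $0$ is the identity of the coefficient group $\mathbb{F}_q$.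
   Context: Generalized Hadamard codes. A $v\times v$ matrix $H=(h_{ij})$ over the additive group $\mathbb{F}_q$, $q\mid v$, is a $\mathrm{GH}(q,v/q)$ if for all $i<j$ the multiset $\{h_{ik}-h_{jk}:1\le k\le v\}$ contains each element of $\mathbb{F}_q$ exactly $v/q$ times; it is normalized if its first row and column are zero. $F_H\subseteq\mathbb{F}_q^v$ is the set of rows of $H$ and $C_H=\bigcup_{\alpha\in\mathbb{F}_q}(F_H+\alpha\mathbf 1)$, with $\mathbf 1$ the all-one vector, is called a generalized Hadamard code. Full propelinear codes. For $\pi\in\mathcal{S}_n$ and $y\in\mathbb{F}_q^n$, $\pi(y)=(y_{\pi^{-1}(1)},\dots,y_{\pi^{-1}(n)})$. A code $C\subseteq\mathbb{F}_q^n$ with $\mathbf 0\in C$ is full propelinear if to every $x\in C$ is assigned $\pi_x\in\mathcal{S}_n$ such that, writing $x\star y=x+\pi_x(y)$: (i) $x\star C=C$ for all $x\in C$; (ii) $\pi_{x\star y}=\pi_x\circ\pi_y$ for all $x,y\in C$; (iii) $\pi_x$ fixes no coordinate if $x\notin\{\alpha\mathbf 1:\alpha\in\mathbb{F}_q\}$, and $\pi_x=\mathrm{Id}$ if $x=\alpha\mathbf 1$ for some $\alpha\in\mathbb{F}_q$. Then $(C,\star)$ is a group with identity $\mathbf 0$. A GHFP-code is a generalized Hadamard code that is full propelinear. The set $C_1$ is a central subgroup of $(C,\star)$ and $F_H$ is a transversal of $C_1$ in $C$. Cocycles. For a finite group $G$ of order $v$ and a finite abelian group $U$ (written additively) of order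 $w$ dividing $v$, a normalized cocycle is a map $\psi:G\times G\to U$ with $\psi(g,h)+\psi(gh,k)=\psi(g,hk)+\psi(h,k)$ and $\psi(g,1)=\psi(1,g)=0$. It is orthogonal if for each $g\neq1$ in $G$ and each $u\in U$, $|\{h\in G:\psi(g,h)=u\}|=v/w$. $E_\psi$ is the group with elements $(u,g)$, $u\in U$, $g\in G$, and product $(u,g)(u',h)=(u+u'+\psi(g,h),gh)$. *)

theory Defs
  imports
    "HOL-Algebra.Coset"
    "HOL-Combinatorics.Permutations"
    "HOL-Library.Multiset"
    "HOL-Library.Cardinality"
    "Jordan_Normal_Form.Matrix"
begin

text \<open>
  The field with \<open>q\<close> elements is a type \<open>'a\<close> of class \<open>{field, finite}\<close> with \<open>CARD('a) = q\<close>
  (so \<open>q\<close> is automatically a prime power). Coordinates, rows and columns are numbered from 0.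
\<close>

section \<open>Generalized Hadamard matrices and codes\<close>

definition GH_matrix :: "nat \<Rightarrow> nat \<Rightarrow> 'a::{field,finite} mat \<Rightarrow> bool" where
  "GH_matrix q l H \<longleftrightarrow>
     q = CARD('a) \<and> 0 < l \<and> H \<in> carrier_mat (q * l) (q * l) \<and>
     (\<forall>i j. i < j \<and> j < q * l \<longrightarrow>
        (\<forall>u. count {# H $$ (i, k) - H $$ (j, k). k \<in># mset_set {0..<q * l} #} u = l))"

definition normalized_mat :: "'a::zero mat \<Rightarrow> bool" where
  "normalized_mat H \<longleftrightarrow>
     (\<forall>k < dim_col H. H $$ (0, k) = 0) \<and> (\<forall>k < dim_row H. H $$ (k, 0) = 0)"

definition all_one :: "nat \<Rightarrow> 'a::field vec" where
  "all_one n = vec n (\<lambda>_. 1)"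

definition constant_words :: "nat \<Rightarrow> 'a::field vec set" where
  "constant_words n = {\<alpha> \<cdot>\<^sub>v all_one n | \<alpha>. True}"

definition row_set :: "'a mat \<Rightarrow> 'a vec set" where
  "row_set H = set (rows H)"

definition GH_code :: "'a::field mat \<Rightarrow> 'a vec set" where
  "GH_code H = (\<Union>\<alpha>. (\<lambda>f. f + \<alpha> \<cdot>\<^sub>v all_one (dim_col H)) ` row_set H)"


section \<open>Full propelinear codes\<close>

definition perm_vec :: "(nat \<Rightarrow> nat) \<Rightarrow> 'a vec \<Rightarrow> 'a vec" where
  "perm_vec p y = vec (dim_vec y) (\<lambda>i. y $ inv_into UNIV p i)"

definition star :: "('a::field vec \<Rightarrow> nat \<Rightarrow> nat) \<Rightarrow> 'a vec \<Rightarrow> 'a vec \<Rightarrow> 'a vec" where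
  "star \<pi> x y = x + perm_vec (\<pi> x) y"

definition full_propelinear ::
    "nat \<Rightarrow> 'a::field vec set \<Rightarrow> ('a vec \<Rightarrow> nat \<Rightarrow> nat) \<Rightarrow> bool" where
  "full_propelinear n C \<pi> \<longleftrightarrow>
     C \<subseteq> carrier_vec n \<and> 0\<^sub>v n \<in> C \<and>
     (\<forall>x\<in>C. \<pi> x permutes {0..<n}) \<and>
     (\<forall>x\<in>C. star \<pi> x ` C = C) \<and>
     (\<forall>x\<in>C. \<forall>y\<in>C. \<pi> (star \<pi> x y) = \<pi> x \<circ> \<pi> y) \<and>
     (\<forall>x\<in>C. (x \<notin> constant_words n \<longrightarrow> (\<forall>i<n. \<pi> x i \<noteq> i)) \<and>
             (x \<in> constant_words n \<longrightarrow> \<pi> x = id))"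

definition propelinear_group ::
    "nat \<Rightarrow> 'a::field vec set \<Rightarrow> ('a vec \<Rightarrow> nat \<Rightarrow> nat) \<Rightarrow> 'a vec monoid" where
  "propelinear_group n C \<pi> = \<lparr>carrier = C, monoid.mult = star \<pi>, one = 0\<^sub>v n\<rparr>"


section \<open>Cocycles\<close>

text \<open>The coefficient group is the additive group of a whole (finite) type.\<close>

definition normalized_cocycle ::
    "('g, 'b) monoid_scheme \<Rightarrow> ('g \<Rightarrow> 'g \<Rightarrow> 'u::ab_group_add) \<Rightarrow> bool" where
  "normalized_cocycle G \<psi> \<longleftrightarrow>
     (\<forall>g\<in>carrier G. \<forall>h\<in>carrier G. \<forall>k\<in>carrier G.
        \<psi> g h + \<psi> (g \<otimes>\<^bsub>G\<^esub> h) k = \<psi> g (h \<otimes>\<^bsub>G\<^esub> k) + \<psi> h k) \<and>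
     (\<forall>g\<in>carrier G. \<psi> g \<one>\<^bsub>G\<^esub> = 0 \<and> \<psi> \<one>\<^bsub>G\<^esub> g = 0)"

definition orthogonal_cocycle ::
    "('g, 'b) monoid_scheme \<Rightarrow> ('g \<Rightarrow> 'g \<Rightarrow> 'u::{ab_group_add,finite}) \<Rightarrow> bool" where
  "orthogonal_cocycle G \<psi> \<longleftrightarrow>
     group G \<and> finite (carrier G) \<and> CARD('u) dvd order G \<and> normalized_cocycle G \<psi> \<and>
     (\<forall>g\<in>carrier G. g \<noteq> \<one>\<^bsub>G\<^esub> \<longrightarrow>
        (\<forall>u. card {h \<in> carrier G. \<psi> g h = u} = order G div CARD('u)))"

text \<open>\<open>e\<close> is the enumeration of the group used to order rows and columns.\<close>

definition cocycle_mat ::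
    "('g, 'b) monoid_scheme \<Rightarrow> (nat \<Rightarrow> 'g) \<Rightarrow> ('g \<Rightarrow> 'g \<Rightarrow> 'u) \<Rightarrow> 'u mat" where
  "cocycle_mat G e \<psi> = mat (order G) (order G) (\<lambda>(i, j). \<psi> (e i) (e j))"

definition cocycle_extension ::
    "('g, 'b) monoid_scheme \<Rightarrow> ('g \<Rightarrow> 'g \<Rightarrow> 'u::ab_group_add) \<Rightarrow> ('u \<times> 'g) monoid" where
  "cocycle_extension G \<psi> =
     \<lparr>carrier = UNIV \<times> carrier G,
      monoid.mult = (\<lambda>(u, g) (u', h). (u + u' + \<psi> g h, g \<otimes>\<^bsub>G\<^esub> h)),
      one = (0, \<one>\<^bsub>G\<^esub>)\<rparr>"


section \<open>The cocycle of a full propelinear generalized Hadamard code\<close>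

definition GHFP_group :: "'a::field mat \<Rightarrow> ('a vec \<Rightarrow> nat \<Rightarrow> nat) \<Rightarrow> 'a vec monoid" where
  "GHFP_group H \<pi> = propelinear_group (dim_col H) (GH_code H) \<pi>"

text \<open>
  \<^const>\<open>FactGroup\<close> consists of right cosets; these coincide with the left cosets
  used in \<open>GHFP_section\<close> because the constant words are central.
\<close>

definition GHFP_quotient :: "'a::field mat \<Rightarrow> ('a vec \<Rightarrow> nat \<Rightarrow> nat) \<Rightarrow> 'a vec set monoid" where
  "GHFP_quotient H \<pi> = GHFP_group H \<pi> Mod constant_words (dim_col H)"

definition GHFP_section ::
    "'a::field mat \<Rightarrow> ('a vec \<Rightarrow> nat \<Rightarrow> nat) \<Rightarrow> 'a vec set \<Rightarrow> 'a vec" where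
  "GHFP_section H \<pi> g =
     (THE f. f \<in> row_set H \<and> g = f <#\<^bsub>GHFP_group H \<pi>\<^esub> constant_words (dim_col H))"

definition in_GHFP_layer ::
    "'a::field mat \<Rightarrow> ('a vec \<Rightarrow> nat \<Rightarrow> nat) \<Rightarrow> 'a vec set \<Rightarrow> 'a vec set \<Rightarrow> 'a \<Rightarrow> bool" where
  "in_GHFP_layer H \<pi> g h k \<longleftrightarrow>
     GHFP_section H \<pi> g \<otimes>\<^bsub>GHFP_group H \<pi>\<^esub> GHFP_section H \<pi> h
       \<in> (k \<cdot>\<^sub>v all_one (dim_col H)) <#\<^bsub>GHFP_group H \<pi>\<^esub> row_set H"

definition GHFP_cocycle ::
    "'a::field mat \<Rightarrow> ('a vec \<Rightarrow> nat \<Rightarrow> nat) \<Rightarrow> 'a vec set \<Rightarrow> 'a vec set \<Rightarrow> 'a" where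
  "GHFP_cocycle H \<pi> g h = (THE k. in_GHFP_layer H \<pi> g h k)"

end

theory Submission imports Defs begin

text \<open>
  Every row of \<open>H\<close> starts with \<open>0\<close>, so the layer of a code word with respect to the transversal
  \<open>F\<^sub>H\<close> of the constant words is its first coordinate. Hence \<open>\<psi>(g, h)\<close> is the first coordinate of
  \<open>\<sigma>(g) \<star> \<sigma>(h)\<close>, and this is the entry of the row \<open>\<sigma>(h)\<close> in column \<open>c(g) = \<pi>\<^sup>-\<^sup>1(0)\<close>, where \<open>\<pi>\<close> is
  the permutation attached to \<open>\<sigma>(g)\<close>. Fixed-point freeness makes \<open>c\<close> injective, so the rows
  of the cocycle matrix are distinct columns of \<open>H\<close> and it suffices that the transpose of a
  generalized Hadamard matrix is again one. The cocycle identity is associativity of \<open>\<star>\<close>, and the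
  isomorphism sends a word to its first coordinate and its coset.
\<close>

section \<open>The transpose of a generalized Hadamard matrix\<close>

text \<open>Both sides count pairs with equal images, on the left grouped by the common image. The
  right-hand side no longer names a value, which lets differences along rows be compared with
  differences along columns.\<close>

lemma sum_card_fibres_squared:
  fixes f :: "'i \<Rightarrow> 'a::finite"
  assumes "finite I"
  shows "(\<Sum>u\<in>UNIV. (int (card {i\<in>I. f i = u}))\<^sup>2) = (\<Sum>i\<in>I. \<Sum>j\<in>I. of_bool (f i = f j))"
proof -
  have card: "int (card {i\<in>I. f i = u}) = (\<Sum>i\<in>I. of_bool (f i = u))" for u
    using assms by (simp add: of_bool_def sum.If_cases Int_def)
  have "(\<Sum>u\<in>UNIV. (int (card {i\<in>I. f i = u}))\<^sup>2) =
      (\<Sum>u\<in>UNIV. \<Sum>i\<in>I. \<Sum>j\<in>I. of_bool (f i = u) * of_bool (f j = u))"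
    by (simp only: card power2_eq_square sum_product)
  also have "\<dots> = (\<Sum>i\<in>I. \<Sum>j\<in>I. \<Sum>u\<in>UNIV. of_bool (f i = u) * of_bool (f j = u))"
    by (subst sum.swap, rule sum.cong[OF refl], rule sum.swap)
  also have "\<dots> = (\<Sum>i\<in>I. \<Sum>j\<in>I. of_bool (f i = f j))"
    by (intro sum.cong refl) (auto simp: of_bool_def if_distrib[of "\<lambda>x. x * _"] cong: if_cong)
  finally show ?thesis .
qed

text \<open>
  The row condition determines the sum of the squared multiplicities over all pairs of columns.
  The value is the smallest one that Cauchy--Schwarz permits, so off the diagonal all
  multiplicities are equal.
\<close>

lemma transpose_uniform_differences:
  fixes a :: "'i \<Rightarrow> 'i \<Rightarrow> 'a::{ab_group_add,finite}"
  assumes I: "finite I" "card I = CARD('a) * l"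
    and rows: "\<And>i j u. i \<in> I \<Longrightarrow> j \<in> I \<Longrightarrow> i \<noteq> j \<Longrightarrow> card {k\<in>I. a i k - a j k = u} = l"
    and jk: "j \<in> I" "k \<in> I" "j \<noteq> k"
  shows "card {i\<in>I. a i j - a i k = u} = l"
proof -
  define w where "w = int (card I)"
  have w: "w = int CARD('a) * int l" by (simp add: w_def I)
  define M where "M i j = (\<Sum>u\<in>UNIV. (int (card {k\<in>I. a i k - a j k = u}))\<^sup>2)" for i j
  define N where "N j k = (\<Sum>u\<in>UNIV. (int (card {i\<in>I. a i j - a i k = u}))\<^sup>2)" for j k
  define D where "D j k = (\<Sum>u\<in>UNIV. (int (card {i\<in>I. a i j - a i k = u}) - int l)\<^sup>2)" for j k
  \<comment> \<open>A row or column compared with itself yields only the difference 0, with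
    multiplicity \<open>w\<close>; the constant function covers both cases.\<close>
  have diag: "(\<Sum>u\<in>UNIV. (int (card {k\<in>I. (0::'a) = u}))\<^sup>2) = w\<^sup>2"
    by (subst sum_card_fibres_squared[OF I(1)]) (simp add: w_def power2_eq_square)
  have M: "M i j = (if i = j then w\<^sup>2 else w * int l)" if "i \<in> I" "j \<in> I" for i j
  proof (cases "i = j")
    case True
    then show ?thesis using diag by (simp add: M_def)
  next
    case False
    then show ?thesis by (simp add: M_def rows that w power2_eq_square)
  qed
  \<comment> \<open>Double counting: \<open>a i j - a i k = a i' j - a i' k\<close> rearranges to
    \<open>a i j - a i' j = a i k - a i' k\<close>, so a coincidence between two columns is one
    between two rows. Moving the sums over \<open>i\<close> and \<open>i'\<close> outward turns the
    total of \<open>N\<close> into that of \<open>M\<close>.\<close>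
  have "(\<Sum>j\<in>I. \<Sum>k\<in>I. N j k) =
      (\<Sum>j\<in>I. \<Sum>k\<in>I. \<Sum>i\<in>I. \<Sum>i'\<in>I. of_bool (a i j - a i' j = a i k - a i' k))"
    unfolding N_def
    by (subst sum_card_fibres_squared[OF I(1)]) (intro sum.cong refl, simp add: algebra_simps)
  also have "\<dots> = (\<Sum>j\<in>I. \<Sum>i\<in>I. \<Sum>k\<in>I. \<Sum>i'\<in>I. of_bool (a i j - a i' j = a i k - a i' k))"
    by (intro sum.cong refl sum.swap)
  also have "\<dots> = (\<Sum>i\<in>I. \<Sum>j\<in>I. \<Sum>k\<in>I. \<Sum>i'\<in>I. of_bool (a i j - a i' j = a i k - a i' k))"
    by (rule sum.swap)
  also have "\<dots> = (\<Sum>i\<in>I. \<Sum>j\<in>I. \<Sum>i'\<in>I. \<Sum>k\<in>I. of_bool (a i j - a i' j = a i k - a i' k))"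
    by (intro sum.cong refl sum.swap)
  also have "\<dots> = (\<Sum>i\<in>I. \<Sum>i'\<in>I. \<Sum>j\<in>I. \<Sum>k\<in>I. of_bool (a i j - a i' j = a i k - a i' k))"
    by (rule sum.cong[OF refl], rule sum.swap)
  also have "\<dots> = (\<Sum>i\<in>I. \<Sum>i'\<in>I. M i i')"
    unfolding M_def by (subst sum_card_fibres_squared[OF I(1)]) simp
  also have "\<dots> = (\<Sum>i\<in>I. \<Sum>i'\<in>I. if i = i' then w\<^sup>2 else w * int l)"
    by (intro sum.cong refl M)
  also have "\<dots> = (\<Sum>i\<in>I. \<Sum>i'\<in>I. (if i = i' then w\<^sup>2 - w * int l else 0) + w * int l)"
    by (intro sum.cong refl) auto
  also have "\<dots> = w * (w\<^sup>2 - w * int l) + w * w * (w * int l)"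
    by (simp add: sum.distrib I(1) algebra_simps flip: w_def)
  finally have N_total: "(\<Sum>j\<in>I. \<Sum>k\<in>I. N j k) = w * (w\<^sup>2 - w * int l) + w * w * (w * int l)" .
  have card_total: "(\<Sum>u\<in>UNIV. int (card {i\<in>I. a i j - a i k = u})) = w" for j k
  proof -
    have "(\<Sum>u\<in>UNIV. card {i\<in>I. a i j - a i k = u}) = card I"
      using I sum.group[of I UNIV "\<lambda>i. a i j - a i k" "\<lambda>_. 1::nat"] by simp
    then show ?thesis unfolding w_def by (simp flip: of_nat_sum)
  qed
  \<comment> \<open>For fixed columns the multiplicities sum to \<open>w\<close>, so
    \<open>l\<close> is their mean and \<open>D\<close> measures the squared deviation from it; the
    cross term is known from the sum.\<close>
  have D: "D j k = N j k - w * int l" for j k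
  proof -
    have "D j k = N j k + int CARD('a) * (int l)\<^sup>2 - 2 * int l * w"
      by (simp add: D_def N_def power2_diff sum.distrib sum_subtractf mult.assoc
          flip: sum_distrib_left sum_distrib_right card_total[of j k])
    then show ?thesis by (simp add: w power2_eq_square)
  qed
  have D_nonneg: "0 \<le> D j k" for j k
    by (simp add: D_def sum_nonneg)
  have "D j j = w\<^sup>2 - w * int l" for j
    using diag by (simp add: D N_def)
  then have D_diag: "(\<Sum>j\<in>I. \<Sum>k\<in>I. if j = k then D j k else 0) = w * (w\<^sup>2 - w * int l)"
    using I(1) by (simp add: w_def)
  \<comment> \<open>The diagonal alone already contributes this amount, so the nonnegative
    off-diagonal terms sum to 0 and vanish one by one.\<close>
  have "(\<Sum>j\<in>I. \<Sum>k\<in>I. D j k) = w * (w\<^sup>2 - w * int l)"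
    by (simp add: D sum_subtractf N_total flip: w_def)
  then have "(\<Sum>j\<in>I. \<Sum>k\<in>I. D j k - (if j = k then D j k else 0)) = 0"
    by (simp only: sum_subtractf D_diag)
  then have total: "(\<Sum>j\<in>I. \<Sum>k\<in>I. if j = k then 0 else D j k) = 0"
    by (subst (asm) sum.cong[OF refl sum.cong[OF refl]]) auto
  have "(\<Sum>k\<in>I. if j = k then 0 else D j k) = 0"
    by (rule sum_nonneg_0[OF I(1) _ total jk(1)]) (rule sum_nonneg, simp add: D_nonneg)
  then have "(if j = k then 0 else D j k) = 0"
    by (rule sum_nonneg_0[OF I(1), rotated]) (auto simp: D_nonneg jk)
  then have "D j k = 0" using jk by simp
  then show ?thesis
    unfolding D_def by (simp add: sum_nonneg_eq_0_iff)
qed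

text \<open>Exchanging the two rows negates every difference, and negation permutes the group, so
  the condition for \<open>i < j\<close> extends to all \<open>i \<noteq> j\<close>. Cardinalities
  of sets replace multiset counts to fit the transposition lemma.\<close>

lemma GH_matrix_iff:
  fixes H :: "'a::{field,finite} mat"
  shows "GH_matrix q l H \<longleftrightarrow>
     q = CARD('a) \<and> 0 < l \<and> H \<in> carrier_mat (q * l) (q * l) \<and>
     (\<forall>i<q * l. \<forall>j<q * l. i \<noteq> j \<longrightarrow>
        (\<forall>u. card {k\<in>{0..<q * l}. H $$ (i, k) - H $$ (j, k) = u} = l))"
proof -
  define N where "N i j u = card {k\<in>{0..<q * l}. H $$ (i, k) - H $$ (j, k) = u}" for i j u
  have count: "count {# H $$ (i, k) - H $$ (j, k). k \<in># mset_set {0..<q * l} #} u = N i j u" for i j u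
    by (simp add: count_image_mset' N_def) (rule arg_cong[of _ _ card], auto)
  have "N j i u = N i j (- u)" for i j u
    unfolding N_def by (rule arg_cong[of _ _ card]) (auto simp: algebra_simps)
  then have sym: "(\<forall>u. N j i u = l) \<longleftrightarrow> (\<forall>u. N i j u = l)" for i j
    by (metis minus_minus)
  have "(\<forall>i j. i < j \<and> j < q * l \<longrightarrow> (\<forall>u. N i j u = l)) \<longleftrightarrow>
      (\<forall>i<q * l. \<forall>j<q * l. i \<noteq> j \<longrightarrow> (\<forall>u. N i j u = l))" (is "?less \<longleftrightarrow> _")
  proof (intro iffI allI impI)
    fix i j u
    assume less: ?less and "i < q * l" "j < q * l" "i \<noteq> j"
    then consider "i < j" | "j < i" by linarith
    then have "\<forall>u. N i j u = l"
      using less \<open>i < q * l\<close> \<open>j < q * l\<close> sym[of i j] by cases blast+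
    then show "N i j u = l" by blast
  qed auto
  then show ?thesis
    unfolding GH_matrix_def count by (simp add: N_def)
qed

section \<open>Full propelinear generalized Hadamard codes\<close>

lemma dim_perm_vec [simp]: "dim_vec (perm_vec p y) = dim_vec y"
  by (simp add: perm_vec_def)

lemma perm_vec_id [simp]: "perm_vec id y = y"
  by (auto simp: perm_vec_def)

lemma index_all_one [simp]: "i < n \<Longrightarrow> all_one n $ i = 1"
  by (simp add: all_one_def)

lemma dim_all_one [simp]: "dim_vec (all_one n) = n"
  by (simp add: all_one_def)

lemma constant_wordsI [simp]: "\<alpha> \<cdot>\<^sub>v all_one n \<in> constant_words n"
  by (auto simp: constant_words_def)

lemma add_constant_words:
  "dim_vec x = n \<Longrightarrow> x + \<alpha> \<cdot>\<^sub>v all_one n + \<beta> \<cdot>\<^sub>v all_one n = x + (\<alpha> + \<beta>) \<cdot>\<^sub>v all_one n"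
  by (auto simp: algebra_simps)

lemma card_preimage_bij_betw:
  assumes "bij_betw f A B"
  shows "card {x\<in>A. p (f x)} = card {y\<in>B. p y}"
proof -
  have "bij_betw f {x\<in>A. p (f x)} {y\<in>B. p y}"
    using assms unfolding bij_betw_def inj_on_def by blast
  then show ?thesis by (rule bij_betw_same_card)
qed

locale GHFP_code =
  fixes H :: "'a::{field,finite} mat" and \<pi> :: "'a vec \<Rightarrow> nat \<Rightarrow> nat" and l v :: nat
  assumes length: "v = CARD('a) * l"
    and GH: "GH_matrix CARD('a) l H"
    and normalized: "normalized_mat H"
    and full_propelinear: "full_propelinear v (GH_code H) \<pi>"
begin

abbreviation "C \<equiv> GH_code H"
abbreviation "F \<equiv> row_set H"
abbreviation "Z \<equiv> constant_words v"
abbreviation const :: "'a \<Rightarrow> 'a vec" where "const \<alpha> \<equiv> \<alpha> \<cdot>\<^sub>v all_one v"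
text \<open>\<open>perm_vec\<close> reads its argument at the inverse permutation: coordinate
  \<open>i\<close> of the permuted word is coordinate \<open>\<rho> x i\<close> of the
  original.\<close>

abbreviation \<rho> :: "'a vec \<Rightarrow> nat \<Rightarrow> nat" where "\<rho> x \<equiv> inv_into UNIV (\<pi> x)"
abbreviation starred (infixl \<open>\<star>\<close> 70) where "x \<star> y \<equiv> star \<pi> x y"
abbreviation "P \<equiv> GHFP_group H \<pi>"
abbreviation "Q \<equiv> GHFP_quotient H \<pi>"
abbreviation "\<sigma> \<equiv> GHFP_section H \<pi>"
abbreviation "\<psi> \<equiv> GHFP_cocycle H \<pi>"

section \<open>Differences of rows and columns of the matrix\<close>

lemma H_carrier: "H \<in> carrier_mat v v" and l_pos: "0 < l"
  using GH by (auto simp: GH_matrix_def length)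

lemma dims [simp]: "dim_row H = v" "dim_col H = v"
  using H_carrier by auto

lemma v_pos [simp]: "0 < v"
  by (simp add: length l_pos)

lemma row_differences:
  assumes "i < v" "j < v" "i \<noteq> j"
  shows "card {k\<in>{0..<v}. H $$ (i, k) - H $$ (j, k) = u} = l"
  using GH assms unfolding GH_matrix_iff length by blast

lemma column_differences:
  assumes "j < v" "k < v" "j \<noteq> k"
  shows "card {i\<in>{0..<v}. H $$ (i, j) - H $$ (i, k) = u} = l"
  by (rule transpose_uniform_differences[where a = "\<lambda>i j. H $$ (i, j)"])
    (use assms in \<open>simp_all only: atLeast0LessThan lessThan_iff finite_lessThan card_lessThan
      length row_differences[unfolded atLeast0LessThan lessThan_iff length] not_False_eq_True\<close>)

lemma row_set_eq: "F = row H ` {0..<v}"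
  by (simp add: row_set_def rows_def)

text \<open>Equal rows have only the difference 0, yet the difference 1 must occur
  \<open>l > 0\<close> times.\<close>

lemma inj_on_row: "inj_on (row H) {0..<v}"
proof (rule inj_onI, rule ccontr)
  fix i j assume ij: "i \<in> {0..<v}" "j \<in> {0..<v}" "row H i = row H j" "i \<noteq> j"
  then have "H $$ (i, k) = H $$ (j, k)" if "k < v" for k
    using that by (metis atLeastLessThan_iff dims index_row(1))
  then have "{k\<in>{0..<v}. H $$ (i, k) - H $$ (j, k) = 1} = {}" by auto
  then show False
    using row_differences[of i j 1] ij l_pos by (metis atLeastLessThan_iff card.empty less_irrefl)
qed

lemma card_row_set: "card F = v"
  by (simp add: row_set_eq card_image inj_on_row)

section \<open>Code words and their first coordinate\<close>

lemma C_carrier: "x \<in> C \<Longrightarrow> dim_vec x = v"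
  using full_propelinear by (auto simp: full_propelinear_def)

lemma zero_in_C [simp]: "0\<^sub>v v \<in> C"
  using full_propelinear by (auto simp: full_propelinear_def)

lemma permutes: "x \<in> C \<Longrightarrow> \<pi> x permutes {0..<v}"
  using full_propelinear by (auto simp: full_propelinear_def)

lemma star_image: "x \<in> C \<Longrightarrow> star \<pi> x ` C = C"
  using full_propelinear by (auto simp: full_propelinear_def)

lemma star_closed [simp]: "x \<in> C \<Longrightarrow> y \<in> C \<Longrightarrow> x \<star> y \<in> C"
  using star_image by blast

lemma perm_star: "x \<in> C \<Longrightarrow> y \<in> C \<Longrightarrow> \<pi> (x \<star> y) = \<pi> x \<circ> \<pi> y"
  using full_propelinear by (auto simp: full_propelinear_def)

lemma perm_const: "x \<in> C \<Longrightarrow> x \<in> Z \<Longrightarrow> \<pi> x = id"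
  using full_propelinear by (auto simp: full_propelinear_def)

lemma const_if_fixed_point: "x \<in> C \<Longrightarrow> i < v \<Longrightarrow> \<pi> x i = i \<Longrightarrow> x \<in> Z"
  using full_propelinear by (auto simp: full_propelinear_def)

lemma in_C_iff: "x \<in> C \<longleftrightarrow> (\<exists>f\<in>F. \<exists>\<alpha>. x = f + const \<alpha>)"
  by (auto simp: GH_code_def)

lemma row_index_0: "f \<in> F \<Longrightarrow> f $ 0 = 0"
  using normalized by (auto simp: row_set_eq normalized_mat_def)

lemma row_dim: "f \<in> F \<Longrightarrow> dim_vec f = v"
  by (auto simp: row_set_eq)

lemma row_in_C [simp]: "f \<in> F \<Longrightarrow> f \<in> C"
  unfolding in_C_iff by (rule bexI[of _ f], rule exI[of _ 0]) (auto simp: row_dim)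

lemma add_const_in_C [simp]: "x \<in> C \<Longrightarrow> x + const \<alpha> \<in> C"
proof -
  assume "x \<in> C"
  then obtain f \<beta> where f: "f \<in> F" "x = f + const \<beta>" unfolding in_C_iff by blast
  then have "x + const \<alpha> = f + const (\<beta> + \<alpha>)"
    by (simp add: row_dim add_constant_words)
  with f show ?thesis unfolding in_C_iff by blast
qed

text \<open>The first column of \<open>H\<close> is zero and adding \<open>const \<alpha>\<close>
  shifts the first coordinate by \<open>\<alpha>\<close>, so the first coordinate alone separates
  the rows from the other code words.\<close>

lemma row_iff: "f \<in> F \<longleftrightarrow> f \<in> C \<and> f $ 0 = 0"
proof
  assume "f \<in> C \<and> f $ 0 = 0"
  then obtain f' \<alpha> where f': "f' \<in> F" "f = f' + const \<alpha>" "f $ 0 = 0" unfolding in_C_iff by blast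
  then have "\<alpha> = 0" by (simp add: row_index_0)
  with f' have "f = f'" by (auto simp: row_dim)
  with f' show "f \<in> F" by simp
qed (simp add: row_index_0)

lemma const_in_C [simp]: "const \<alpha> \<in> C"
proof -
  have "0\<^sub>v v + const \<alpha> \<in> C" by (rule add_const_in_C) simp
  also have "0\<^sub>v v + const \<alpha> = const \<alpha>" by auto
  finally show ?thesis .
qed

lemma Z_subset: "Z \<subseteq> C"
  by (auto simp: constant_words_def)

section \<open>The propelinear operation in coordinates\<close>

lemma inv_perm_lt: "x \<in> C \<Longrightarrow> i < v \<Longrightarrow> \<rho> x i < v"
  using permutes_in_image[OF permutes_inv[OF permutes]] by auto

lemma star_index: "x \<in> C \<Longrightarrow> y \<in> C \<Longrightarrow> i < v \<Longrightarrow> (x \<star> y) $ i = x $ i + y $ \<rho> x i"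
  by (simp add: star_def perm_vec_def C_carrier)

lemma eqI: "x \<in> C \<Longrightarrow> y \<in> C \<Longrightarrow> (\<And>i. i < v \<Longrightarrow> x $ i = y $ i) \<Longrightarrow> x = y"
  by (auto simp: C_carrier)

text \<open>Permuting coordinates leaves a constant word unchanged. Together with
  \<open>const_star\<close>, where the permutation is the identity, this makes the constant words
  central.\<close>

lemma star_const: "x \<in> C \<Longrightarrow> x \<star> const \<alpha> = x + const \<alpha>"
  by (rule eqI) (auto simp: star_index inv_perm_lt C_carrier)

lemma const_star: "x \<in> C \<Longrightarrow> const \<alpha> \<star> x = x + const \<alpha>"
  by (rule eqI) (auto simp: star_index perm_const C_carrier)

lemma perm_add_const: "x \<in> C \<Longrightarrow> \<pi> (x + const \<alpha>) = \<pi> x"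
  using perm_star[of x "const \<alpha>"] by (simp add: star_const perm_const)

lemma star_add_const:
  assumes "x \<in> C" "y \<in> C"
  shows "(x + const \<alpha>) \<star> (y + const \<beta>) = x \<star> y + const (\<alpha> + \<beta>)"
  by (rule eqI)
    (use assms in \<open>auto simp: star_index perm_add_const inv_perm_lt C_carrier\<close>)

text \<open>The inverse of \<open>\<pi> x \<circ> \<pi> y\<close> is
  \<open>\<rho> y \<circ> \<rho> x\<close>, so at coordinate \<open>i\<close> both sides equal
  \<open>x $ i + y $ \<rho> x i + z $ \<rho> y (\<rho> x i)\<close>.\<close>

lemma star_assoc:
  assumes "x \<in> C" "y \<in> C" "z \<in> C"
  shows "x \<star> y \<star> z = x \<star> (y \<star> z)"
  by (rule eqI)
    (use assms in \<open>auto simp: star_index perm_star inv_perm_lt o_inv_distrib permutes_bij[OF permutes]\<close>)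

section \<open>The group of code words and its quotient by the constant words\<close>

lemma P_simps [simp]: "carrier P = C" "x \<otimes>\<^bsub>P\<^esub> y = x \<star> y" "\<one>\<^bsub>P\<^esub> = 0\<^sub>v v"
  by (simp_all add: GHFP_group_def propelinear_group_def)

lemma zero_eq_const: "0\<^sub>v v = const 0"
  by auto

lemma star_zero: "x \<in> C \<Longrightarrow> x \<star> 0\<^sub>v v = x" and zero_star: "x \<in> C \<Longrightarrow> 0\<^sub>v v \<star> x = x"
  unfolding zero_eq_const by (auto simp: star_const const_star C_carrier)

lemma group_P: "group P"
proof (rule groupI)
  \<comment> \<open>\<open>star \<pi> x\<close> maps \<open>C\<close> onto \<open>C\<close>, so it
    attains 0, which gives right inverses, while \<open>groupI\<close> asks for left ones. If
    \<open>y\<close> is a right inverse of \<open>x\<close> and \<open>z\<close> one of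
    \<open>y\<close>, associativity forces \<open>x = z\<close>.\<close>
  have right_inv: "\<exists>y\<in>C. x \<star> y = 0\<^sub>v v" if "x \<in> C" for x
    using star_image[OF that] zero_in_C by (metis imageE)
  fix x assume "x \<in> carrier P"
  then have x: "x \<in> C" by simp
  then obtain y where y: "y \<in> C" "x \<star> y = 0\<^sub>v v" using right_inv by blast
  then obtain z where z: "z \<in> C" "y \<star> z = 0\<^sub>v v" using right_inv by blast
  have "x = z" using x y z star_assoc[of x y z] by (simp add: star_zero zero_star)
  with y z show "\<exists>y\<in>carrier P. y \<otimes>\<^bsub>P\<^esub> x = \<one>\<^bsub>P\<^esub>" by auto
qed (simp_all add: star_assoc zero_star)

lemma normal_Z: "Z \<lhd> P"
proof (rule group.normalI[OF group_P])
  show "subgroup Z P"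
  proof (rule group.subgroupI[OF group_P])
    fix a :: "'a vec" assume "a \<in> Z"
    then obtain \<alpha> where a: "a = const \<alpha>" by (auto simp: constant_words_def)
    have "const (- \<alpha>) \<star> const \<alpha> = const \<alpha> + const (- \<alpha>)" by (rule const_star) simp
    also have "\<dots> = 0\<^sub>v v" by auto
    finally have "inv\<^bsub>P\<^esub> a = const (- \<alpha>)"
      unfolding a by (intro group.inv_equality[OF group_P]) auto
    then show "inv\<^bsub>P\<^esub> a \<in> Z" by simp
  next
    fix a b :: "'a vec" assume "a \<in> Z" "b \<in> Z"
    then obtain \<alpha> \<beta> where "a = const \<alpha>" "b = const \<beta>" by (auto simp: constant_words_def)
    then have "a \<star> b = const (\<alpha> + \<beta>)" by (auto simp: star_const)
    then show "a \<otimes>\<^bsub>P\<^esub> b \<in> Z" by simp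
  qed (use Z_subset in auto, auto simp: constant_words_def)
  show "\<forall>x\<in>carrier P. Z #>\<^bsub>P\<^esub> x = x <#\<^bsub>P\<^esub> Z"
    by (auto simp: r_coset_def l_coset_def constant_words_def star_const const_star)
qed

lemma group_Q: "group Q"
  using normal.factorgroup_is_group[OF normal_Z] by (simp add: GHFP_quotient_def)

lemma one_Q: "\<one>\<^bsub>Q\<^esub> = Z"
  by (simp add: GHFP_quotient_def)

lemma word_coset_eq: "x \<in> C \<Longrightarrow> x <#\<^bsub>P\<^esub> Z = {x + const \<alpha> | \<alpha>. True}"
  by (auto simp: l_coset_def constant_words_def star_const)

lemma coset_add_const:
  assumes "x \<in> C"
  shows "(x + const \<alpha>) <#\<^bsub>P\<^esub> Z = x <#\<^bsub>P\<^esub> Z"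
proof -
  have "x + const \<alpha> + const \<beta> = x + const (\<alpha> + \<beta>)" for \<beta>
    using assms by (simp add: C_carrier add_constant_words)
  then have "(x + const \<alpha>) <#\<^bsub>P\<^esub> Z = {x + const (\<alpha> + \<beta>) | \<beta>. True}"
    using assms by (simp add: word_coset_eq)
  also have "\<dots> = {x + const \<alpha> | \<alpha>. True}"
    by auto (metis diff_add_cancel add.commute)
  finally show ?thesis using assms by (simp add: word_coset_eq)
qed

section \<open>The rows as a transversal of the constant words\<close>

lemma row_of_word:
  assumes "x \<in> C"
  obtains f where "f \<in> F" "x = f + const (x $ 0)"
proof -
  obtain f \<alpha> where "f \<in> F" "x = f + const \<alpha>" using assms unfolding in_C_iff by blast
  then show ?thesis using that[of f] by (simp add: row_index_0)
qed

text \<open>Two rows in one coset differ by a constant word; their first coordinates are both 0, so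
  that constant is 0.\<close>

lemma coset_inject:
  assumes "f \<in> F" "f' \<in> F" "f <#\<^bsub>P\<^esub> Z = f' <#\<^bsub>P\<^esub> Z"
  shows "f = f'"
proof -
  have "f + const 0 \<in> f' <#\<^bsub>P\<^esub> Z" using assms by (auto simp: word_coset_eq)
  then obtain \<alpha> where \<alpha>: "f + const 0 = f' + const \<alpha>" using assms by (auto simp: word_coset_eq)
  moreover have "f + const 0 = f" using assms by (auto simp: row_dim)
  ultimately have eq: "f = f' + const \<alpha>" by simp
  then have "f $ 0 = f' $ 0 + \<alpha>" by simp
  then have "\<alpha> = 0" using assms by (simp add: row_index_0)
  with eq show ?thesis using assms by (auto simp: row_dim)
qed

text \<open>Normality converts the right cosets of the quotient into the left cosets used by
  \<open>GHFP_section\<close>.\<close>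

lemma carrier_Q: "carrier Q = (\<lambda>x. x <#\<^bsub>P\<^esub> Z) ` C"
  using normal.coset_eq[OF normal_Z] by (simp add: GHFP_quotient_def carrier_FactGroup)

lemma carrier_Q_rows: "carrier Q = (\<lambda>f. f <#\<^bsub>P\<^esub> Z) ` F"
proof -
  have "x <#\<^bsub>P\<^esub> Z \<in> (\<lambda>f. f <#\<^bsub>P\<^esub> Z) ` F" if "x \<in> C" for x
    using row_of_word[OF that] coset_add_const row_in_C by (metis image_eqI)
  then show ?thesis by (auto simp: carrier_Q)
qed

lemma mult_Q:
  assumes "x \<in> C" "y \<in> C"
  shows "(x <#\<^bsub>P\<^esub> Z) \<otimes>\<^bsub>Q\<^esub> (y <#\<^bsub>P\<^esub> Z) = (x \<star> y) <#\<^bsub>P\<^esub> Z"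
  using normal.rcos_sum[OF normal_Z, of x y] normal.coset_eq[OF normal_Z] assms
  by (simp add: GHFP_quotient_def FactGroup_def)

lemma ex1_section: "g \<in> carrier Q \<Longrightarrow> \<exists>!f. f \<in> F \<and> g = f <#\<^bsub>P\<^esub> Z"
  using coset_inject by (auto simp: carrier_Q_rows)

lemma section_coset: "f \<in> F \<Longrightarrow> \<sigma> (f <#\<^bsub>P\<^esub> Z) = f"
  unfolding GHFP_section_def by (rule the_equality) (auto dest: coset_inject)

lemma section_in_rows [simp]: "g \<in> carrier Q \<Longrightarrow> \<sigma> g \<in> F"
  by (auto simp: carrier_Q_rows section_coset)

lemma coset_section: "g \<in> carrier Q \<Longrightarrow> \<sigma> g <#\<^bsub>P\<^esub> Z = g"
  by (auto simp: carrier_Q_rows section_coset)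

lemma bij_betw_section: "bij_betw \<sigma> (carrier Q) F"
  by (rule bij_betw_byWitness[where f' = "\<lambda>f. f <#\<^bsub>P\<^esub> Z"])
    (auto simp: carrier_Q_rows section_coset)

lemma order_Q: "order Q = v"
  using bij_betw_same_card[OF bij_betw_section] by (simp add: order_def card_row_set)

lemma section_one: "\<sigma> \<one>\<^bsub>Q\<^esub> = 0\<^sub>v v"
proof -
  have "0\<^sub>v v \<in> F" by (simp add: row_iff)
  moreover have "0\<^sub>v v + const \<alpha> = const \<alpha>" for \<alpha>
    by auto
  then have "0\<^sub>v v <#\<^bsub>P\<^esub> Z = Z"
    by (simp add: word_coset_eq) (simp add: constant_words_def)
  ultimately show ?thesis using section_coset[of "0\<^sub>v v"] by (simp add: one_Q)
qed

subsection \<open>The cocycle\<close>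

text \<open>Layer \<open>k\<close> is the translate of \<open>F\<close> by \<open>const k\<close>,
  whose words all start with \<open>k\<close>; conversely \<open>row_of_word\<close> puts a word
  into the layer of its first coordinate. So exactly one \<open>k\<close> qualifies and the
  description defining \<open>\<psi>\<close> denotes it.\<close>

lemma in_layer_iff:
  assumes "g \<in> carrier Q" "h \<in> carrier Q"
  shows "in_GHFP_layer H \<pi> g h k \<longleftrightarrow> (\<sigma> g \<star> \<sigma> h) $ 0 = k"
proof -
  have layer: "const k <#\<^bsub>P\<^esub> F = (\<lambda>f. f + const k) ` F"
    by (auto simp: l_coset_def const_star)
  have x: "\<sigma> g \<star> \<sigma> h \<in> C" using assms by simp
  obtain f where f: "f \<in> F" "\<sigma> g \<star> \<sigma> h = f + const ((\<sigma> g \<star> \<sigma> h) $ 0)"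
    using row_of_word[OF x] .
  then have "\<sigma> g \<star> \<sigma> h \<in> (\<lambda>f. f + const k) ` F" if "(\<sigma> g \<star> \<sigma> h) $ 0 = k"
    using that by blast
  moreover have "(\<sigma> g \<star> \<sigma> h) $ 0 = k" if "\<sigma> g \<star> \<sigma> h \<in> (\<lambda>f. f + const k) ` F"
    using that by (auto simp: row_index_0)
  ultimately show ?thesis
    by (auto simp: in_GHFP_layer_def layer)
qed

lemma cocycle_eq:
  "g \<in> carrier Q \<Longrightarrow> h \<in> carrier Q \<Longrightarrow> \<psi> g h = (\<sigma> g \<star> \<sigma> h) $ 0"
  by (simp add: GHFP_cocycle_def in_layer_iff)

text \<open>Removing the first coordinate from the product leaves a row in the same coset, and the
  only row in that coset is the section of the product. Thus \<open>\<psi>\<close> is the factor set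
  of the transversal \<open>F\<close>.\<close>

lemma section_mult:
  assumes "g \<in> carrier Q" "h \<in> carrier Q"
  shows "\<sigma> g \<star> \<sigma> h = \<sigma> (g \<otimes>\<^bsub>Q\<^esub> h) + const (\<psi> g h)"
proof -
  have x: "\<sigma> g \<star> \<sigma> h \<in> C" using assms by simp
  obtain f where f: "f \<in> F" "\<sigma> g \<star> \<sigma> h = f + const (\<psi> g h)"
    using row_of_word[OF x] assms by (metis cocycle_eq)
  have "g \<otimes>\<^bsub>Q\<^esub> h = (\<sigma> g \<star> \<sigma> h) <#\<^bsub>P\<^esub> Z"
    using mult_Q[of "\<sigma> g" "\<sigma> h"] assms by (simp add: coset_section)
  then have "\<sigma> (g \<otimes>\<^bsub>Q\<^esub> h) = f"
    using f by (simp add: coset_add_const section_coset)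
  with f show ?thesis by simp
qed

lemma normalized_cocycle: "normalized_cocycle Q \<psi>"
proof -
  interpret Q: group Q by (rule group_Q)
  have "\<psi> g h + \<psi> (g \<otimes>\<^bsub>Q\<^esub> h) k = \<psi> g (h \<otimes>\<^bsub>Q\<^esub> k) + \<psi> h k"
    if g: "g \<in> carrier Q" and h: "h \<in> carrier Q" and k: "k \<in> carrier Q" for g h k
  proof -
    \<comment> \<open>The first coordinate of the triple product, read in the two bracketings, gives
      the two sides of the cocycle identity. The constant 0 passed to \<open>star_add_const\<close>
      leaves the other factor untouched.\<close>
    have "\<sigma> g \<star> \<sigma> h \<star> \<sigma> k = \<sigma> (g \<otimes>\<^bsub>Q\<^esub> h) \<star> \<sigma> k + const (\<psi> g h)"
      using star_add_const[of "\<sigma> (g \<otimes>\<^bsub>Q\<^esub> h)" "\<sigma> k" "\<psi> g h" 0] g h k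
      by (simp add: section_mult[OF g h] zero_eq_const[symmetric] row_dim carrier_vecI)
    then have 1: "(\<sigma> g \<star> \<sigma> h \<star> \<sigma> k) $ 0 = \<psi> (g \<otimes>\<^bsub>Q\<^esub> h) k + \<psi> g h"
      using g h k by (simp add: cocycle_eq[of "g \<otimes>\<^bsub>Q\<^esub> h" k])
    have "\<sigma> g \<star> (\<sigma> h \<star> \<sigma> k) = \<sigma> g \<star> \<sigma> (h \<otimes>\<^bsub>Q\<^esub> k) + const (\<psi> h k)"
      using star_add_const[of "\<sigma> g" "\<sigma> (h \<otimes>\<^bsub>Q\<^esub> k)" 0 "\<psi> h k"] g h k
      by (simp add: section_mult[OF h k] zero_eq_const[symmetric] row_dim carrier_vecI)
    then have 2: "(\<sigma> g \<star> (\<sigma> h \<star> \<sigma> k)) $ 0 = \<psi> g (h \<otimes>\<^bsub>Q\<^esub> k) + \<psi> h k"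
      using g h k by (simp add: cocycle_eq[of g "h \<otimes>\<^bsub>Q\<^esub> k"])
    show ?thesis
      using 1 2 star_assoc[of "\<sigma> g" "\<sigma> h" "\<sigma> k"] g h k by (simp add: add.commute)
  qed
  moreover have "\<psi> g \<one>\<^bsub>Q\<^esub> = 0" "\<psi> \<one>\<^bsub>Q\<^esub> g = 0" if "g \<in> carrier Q" for g
    using that by (simp_all add: cocycle_eq section_one star_zero zero_star row_index_0)
  ultimately show ?thesis
    by (simp add: normalized_cocycle_def)
qed

section \<open>Orthogonality of the cocycle\<close>

lemma cocycle_index:
  "g \<in> carrier Q \<Longrightarrow> h \<in> carrier Q \<Longrightarrow> \<psi> g h = \<sigma> h $ \<rho> (\<sigma> g) 0"
  by (simp add: cocycle_eq star_index row_index_0)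

text \<open>The quotient of two permutations that agree at a coordinate has a fixed point, so the
  word to which it belongs is constant and the two rows share a coset. For \<open>i = 0\<close> this
  says that distinct group elements select distinct columns of \<open>H\<close>.\<close>

lemma row_eq_if_same_preimage:
  assumes f: "f \<in> F" "f' \<in> F" and eq: "\<rho> f i = \<rho> f' i" and i: "i < v"
  shows "f = f'"
proof -
  define c where "c = \<rho> f i"
  have c: "c < v" using f i by (simp add: c_def inv_perm_lt)
  have bij: "bij (\<pi> f)" "bij (\<pi> f')" using f permutes_bij permutes row_in_C by blast+
  have img: "\<pi> f c = i" "\<pi> f' c = i"
    by (simp add: c_def bij_is_surj[OF bij(1)] surj_f_inv_f)
      (simp add: c_def eq bij_is_surj[OF bij(2)] surj_f_inv_f)
  \<comment> \<open>\<open>y\<close> is the quotient of \<open>f\<close> by \<open>f'\<close> in the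
    group, available because \<open>star \<pi> f'\<close> is onto; its permutation fixes
    \<open>c\<close>.\<close>
  obtain y where y: "y \<in> C" "f = f' \<star> y"
    using star_image[of f'] f by (metis imageE row_in_C)
  then have "\<pi> f' (\<pi> y c) = \<pi> f' c"
    using img f by (simp add: perm_star)
  then have "\<pi> y c = c" using bij by (metis bij_is_inj injD)
  then have "y \<in> Z" using y c const_if_fixed_point by blast
  then obtain \<alpha> where "y = const \<alpha>" by (auto simp: constant_words_def)
  with y f have "f <#\<^bsub>P\<^esub> Z = f' <#\<^bsub>P\<^esub> Z"
    by (simp add: star_const coset_add_const)
  with f show ?thesis by (intro coset_inject)
qed

text \<open>By \<open>cocycle_index\<close> the two rows of the cocycle matrix are two distinct
  columns of \<open>H\<close>; the bijections from cosets to rows and from indices to rows carry the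
  count over to \<open>column_differences\<close>.\<close>

lemma cocycle_differences:
  assumes g: "g \<in> carrier Q" "g' \<in> carrier Q" "g \<noteq> g'"
  shows "card {h\<in>carrier Q. \<psi> g h - \<psi> g' h = u} = l"
proof -
  define j where "j = \<rho> (\<sigma> g) 0"
  define k where "k = \<rho> (\<sigma> g') 0"
  have jk: "j < v" "k < v" using g by (simp_all add: j_def k_def inv_perm_lt)
  have "\<sigma> g \<noteq> \<sigma> g'" using g by (metis coset_section)
  then have "j \<noteq> k"
    using g row_eq_if_same_preimage[of "\<sigma> g" "\<sigma> g'" 0] by (auto simp: j_def k_def)
  have "{h\<in>carrier Q. \<psi> g h - \<psi> g' h = u} = {h\<in>carrier Q. \<sigma> h $ j - \<sigma> h $ k = u}"
    using g by (auto simp: cocycle_index j_def k_def)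
  also have "card \<dots> = card {f\<in>F. f $ j - f $ k = u}"
    by (rule card_preimage_bij_betw[OF bij_betw_section])
  also have "\<dots> = card {i\<in>{0..<v}. row H i $ j - row H i $ k = u}"
    by (rule card_preimage_bij_betw[symmetric]) (simp add: row_set_eq inj_on_row bij_betw_def)
  also have "{i\<in>{0..<v}. row H i $ j - row H i $ k = u} = {i\<in>{0..<v}. H $$ (i, j) - H $$ (i, k) = u}"
    using jk by auto
  also have "card \<dots> = l"
    by (rule column_differences) fact+
  finally show ?thesis .
qed

lemma orthogonal_cocycle: "orthogonal_cocycle Q \<psi>"
proof -
  have "finite (carrier Q)"
    by (simp add: carrier_Q_rows row_set_eq)
  moreover have "card {h\<in>carrier Q. \<psi> g h = u} = l" if "g \<in> carrier Q" "g \<noteq> \<one>\<^bsub>Q\<^esub>" for g u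
  proof -
    have "\<one>\<^bsub>Q\<^esub> \<in> carrier Q" using group_Q by (simp add: group.is_monoid)
    \<comment> \<open>Against the identity, where the normalized cocycle is 0, the difference is
      \<open>\<psi> g h\<close> itself.\<close>
    from cocycle_differences[OF that(1) this that(2), of u] show ?thesis
      using normalized_cocycle by (simp add: normalized_cocycle_def cong: conj_cong)
  qed
  ultimately show ?thesis
    using group_Q normalized_cocycle
    by (simp add: orthogonal_cocycle_def order_Q length)
qed

lemma GH_matrix_cocycle_mat:
  assumes e: "bij_betw e {0..<order Q} (carrier Q)"
  shows "GH_matrix CARD('a) l (cocycle_mat Q e \<psi>)"
proof -
  have e: "bij_betw e {0..<v} (carrier Q)" using e by (simp add: order_Q)
  have "card {k\<in>{0..<v}. \<psi> (e i) (e k) - \<psi> (e j) (e k) = u} = l"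
    if ij: "i < v" "j < v" "i \<noteq> j" for i j u
  proof -
    have "e i \<in> carrier Q" "e j \<in> carrier Q"
      using bij_betwE[OF e] ij by simp_all
    moreover have "e i \<noteq> e j"
      using bij_betw_imp_inj_on[OF e] ij by (simp add: inj_on_eq_iff)
    ultimately show ?thesis
      using card_preimage_bij_betw[OF e, of "\<lambda>h. \<psi> (e i) h - \<psi> (e j) h = u"]
        cocycle_differences[of "e i" "e j" u] by simp
  qed
  moreover have "{k\<in>{0..<v}. cocycle_mat Q e \<psi> $$ (i, k) - cocycle_mat Q e \<psi> $$ (j, k) = u} =
      {k\<in>{0..<v}. \<psi> (e i) (e k) - \<psi> (e j) (e k) = u}" if "i < v" "j < v" for i j u
    using that by (auto simp: cocycle_mat_def order_Q)
  ultimately show ?thesis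
    unfolding GH_matrix_iff length[symmetric]
    by (simp add: l_pos) (simp add: cocycle_mat_def order_Q)
qed

section \<open>The isomorphism with the cocycle extension\<close>

definition to_extension :: "'a vec \<Rightarrow> 'a \<times> 'a vec set" where
  "to_extension x = (x $ 0, x <#\<^bsub>P\<^esub> Z)"

lemma to_extension_section:
  "g \<in> carrier Q \<Longrightarrow> to_extension (\<sigma> g + const u) = (u, g)"
  by (simp add: to_extension_def row_index_0 coset_add_const coset_section)

lemma word_cases:
  assumes "x \<in> C"
  obtains g u where "g \<in> carrier Q" "x = \<sigma> g + const u"
proof -
  obtain f where "f \<in> F" "x = f + const (x $ 0)" using row_of_word[OF assms] .
  then show ?thesis
    using that[of "f <#\<^bsub>P\<^esub> Z" "x $ 0"] by (simp add: section_coset carrier_Q)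
qed

lemma to_extension_iso: "to_extension \<in> iso P (cocycle_extension Q \<psi>)"
proof (rule isoI)
  interpret Q: group Q by (rule group_Q)
  show "to_extension \<in> hom P (cocycle_extension Q \<psi>)"
  proof (rule homI)
    fix x assume "x \<in> carrier P"
    then show "to_extension x \<in> carrier (cocycle_extension Q \<psi>)"
      by (auto simp: to_extension_def cocycle_extension_def carrier_Q)
  next
    fix x y assume "x \<in> carrier P" "y \<in> carrier P"
    then have "x \<in> C" "y \<in> C" by simp_all
    then obtain g u h w where g: "g \<in> carrier Q" "x = \<sigma> g + const u"
      and h: "h \<in> carrier Q" "y = \<sigma> h + const w" by (metis word_cases)
    \<comment> \<open>Constants are central, so \<open>u\<close>, \<open>w\<close> and the cocycle
      value collect into one constant, the first component of the product in the extension.\<close>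
    have "x \<star> y = \<sigma> (g \<otimes>\<^bsub>Q\<^esub> h) + const (\<psi> g h) + const (u + w)"
      using g h by (simp add: star_add_const section_mult)
    also have "\<dots> = \<sigma> (g \<otimes>\<^bsub>Q\<^esub> h) + const (u + w + \<psi> g h)"
      using g h by (simp add: row_dim add_constant_words ac_simps)
    finally show "to_extension (x \<otimes>\<^bsub>P\<^esub> y) =
        to_extension x \<otimes>\<^bsub>cocycle_extension Q \<psi>\<^esub> to_extension y"
      using g h by (simp add: to_extension_section cocycle_extension_def)
  qed
  \<comment> \<open>The inverse rebuilds a word from its coset's row and its first
    coordinate.\<close>
  show "bij_betw to_extension (carrier P) (carrier (cocycle_extension Q \<psi>))"
    by (rule bij_betw_byWitness[where f' = "\<lambda>(u, g). \<sigma> g + const u"])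
      (auto simp: cocycle_extension_def to_extension_section elim!: word_cases)
qed

lemma to_extension_rows: "to_extension ` F = {(0, g) | g. g \<in> carrier Q}"
  by (auto simp: to_extension_def row_index_0 carrier_Q_rows image_iff)

end

text \<open>The first two conjuncts guarantee that the definite descriptions behind the section and
  the cocycle denote. The enumeration \<open>e\<close> is arbitrary, so the matrix claim holds for
  every ordering of the group.\<close>

theorem corollary3p9:
  fixes H :: "'a::{field,finite} mat" and \<pi> :: "'a vec \<Rightarrow> nat \<Rightarrow> nat" and q v :: nat
  assumes "CARD('a) = q" and "q dvd v"
    and "GH_matrix q (v div q) H"
    and "normalized_mat H"
    and "full_propelinear v (GH_code H) \<pi>"
  shows "(\<forall>g\<in>carrier (GHFP_quotient H \<pi>). \<exists>!f. f \<in> row_set H \<and>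
            g = f <#\<^bsub>GHFP_group H \<pi>\<^esub> constant_words v)
    \<and> (\<forall>g\<in>carrier (GHFP_quotient H \<pi>). \<forall>h\<in>carrier (GHFP_quotient H \<pi>).
         \<exists>!k. in_GHFP_layer H \<pi> g h k)
    \<and> orthogonal_cocycle (GHFP_quotient H \<pi>) (GHFP_cocycle H \<pi>)
    \<and> (\<forall>e. bij_betw e {0..<order (GHFP_quotient H \<pi>)} (carrier (GHFP_quotient H \<pi>)) \<longrightarrow>
         GH_matrix q (v div q) (cocycle_mat (GHFP_quotient H \<pi>) e (GHFP_cocycle H \<pi>)))
    \<and> (\<exists>\<phi> \<in> iso (GHFP_group H \<pi>) (cocycle_extension (GHFP_quotient H \<pi>) (GHFP_cocycle H \<pi>)).
         \<phi> ` row_set H = {(0, g) | g. g \<in> carrier (GHFP_quotient H \<pi>)})"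
proof -
  \<comment> \<open>Since \<open>q dvd v\<close>, the choice \<open>l = v div q\<close> satisfies
    \<open>v = CARD('a) * l\<close>.\<close>
  interpret GHFP_code H \<pi> "v div q" v
    using assms by unfold_locales auto
  show ?thesis
    using ex1_section in_layer_iff orthogonal_cocycle GH_matrix_cocycle_mat
      to_extension_iso to_extension_rows assms(1) by auto
qed

end
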